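(* Let $L\in\mathbb{R}^{n\times n}$ be irreducible with zero column sums, spectral abscissa $0$ with $0$ a simple eigenvalue, and eventually exponentially positive. Let $\Pi$ be the spectral projector of $L$ for the eigenvalue $0$ and $\boldsymbol p^\infty$ the stationary density. Let $r$ be an A-acceptable rational function with $r(0)=1$ and finite $r(\infty)$, whose poles avoid $\operatorname{spec}(\gamma L)$ for all $\gamma>0$. Then $$\lim_{\gamma\to\infty} r(\gamma L)=\Pi+r(\infty)\,(\mathcal I-\Pi),$$ and the entries of this limit in row $i$ are $p^\infty_i\,(1-r(\infty))$ off the diagonal and $p^\infty_i+r(\infty)\,(1-p^\infty_i)$ on the diagonal.
   Context: $\mathcal I$ is the identity matrix. $L$ is eventually exponentially positive if there is $\tau_0\ge0$ such that $e^{tL}$ is entrywise strictly positive for all $t\ge\tau_0$. The spectral abscissa is the maximal real part of the eigenvalues. The stationary density $\boldsymbol p^\infty$ is the right null vector of $L$ normalized by $\sum_i p^\infty_i=1$ (it is entrywise positive), and $\Pi=\lim_{t\to\infty}e^{tL}$ is the spectral projector onto $\ker L=\operatorname{span}(\boldsymbol p^\infty)$ along $\operatorname{ran}L$, with entries $\Pi_{ij}=p^\infty_i$. A rational function $r$ is called A-acceptable if all its poles lie in the open right half-plane. $r(\infty)=\lim_{|z|\to\infty}r(z)$. For a rational function $r=P/Q$ (coprime polynomials) whose poles are not eigenvalues of a matrix $M$, $r(M)=P(M)Q(M)^{-1}$. *)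

theory Defs
  imports "HOL-Complex_Analysis.Complex_Analysis"
begin

section \<open>Powers, polynomials and exponential of a matrix\<close>

text \<open>
  On \<open>'a^'n^'n\<close> the overloaded \<open>*\<close>, \<open>^\<close> and \<open>1\<close> act componentwise, so powers are built from
  \<open>**\<close> and \<open>mat 1\<close>, and \<open>c *s A\<close> is not multiplication of a matrix by a scalar.
\<close>

definition matrix_power :: "'a::semiring_1 ^'n^'n \<Rightarrow> nat \<Rightarrow> 'a ^'n^'n" where
  "matrix_power A k = ((**) A ^^ k) (mat 1)"

definition matrix_scale :: "'a::times \<Rightarrow> 'a ^'n^'m \<Rightarrow> 'a ^'n^'m" where
  "matrix_scale c A = map_matrix ((*) c) A"

definition matrix_poly :: "'a::comm_ring_1 poly \<Rightarrow> 'a ^'n^'n \<Rightarrow> 'a ^'n^'n" where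
  "matrix_poly P A = (\<Sum>k\<le>degree P. matrix_scale (coeff P k) (matrix_power A k))"

definition matrix_exp :: "real ^'n^'n \<Rightarrow> real ^'n^'n" where
  "matrix_exp A = (\<Sum>k. (1 / fact k) *\<^sub>R matrix_power A k)"

abbreviation cmatrix :: "real ^'n^'m \<Rightarrow> complex ^'n^'m" where
  "cmatrix \<equiv> map_matrix complex_of_real"


section \<open>Spectrum\<close>

definition spectrum :: "complex ^'n^'n \<Rightarrow> complex set" where
  "spectrum A = {z. \<exists>v. v \<noteq> 0 \<and> A *v v = z *s v}"

definition charpoly :: "'a::comm_ring_1 ^'n^'n \<Rightarrow> 'a poly" where
  "charpoly A = det (mat [:0, 1:] - map_matrix (\<lambda>a. [:a:]) A)"

text \<open>Simple means algebraic multiplicity one.\<close>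

definition simple_eigenvalue :: "complex ^'n^'n \<Rightarrow> complex \<Rightarrow> bool" where
  "simple_eigenvalue A z \<longleftrightarrow> z \<in> spectrum A \<and> order z (charpoly A) = 1"

definition spectral_abscissa :: "real ^'n^'n \<Rightarrow> real" where
  "spectral_abscissa L = Max (Re ` spectrum (cmatrix L))"

lemma poly_charpoly: "poly (charpoly A) z = det (mat z - A)"
  for A :: "'a::comm_ring_1 ^'n^'n"
proof -
  have "poly (det B) z = det (map_matrix (\<lambda>p. poly p z) B)" for B :: "'a poly ^'n^'n"
    by (simp add: det_def poly_sum poly_prod)
  moreover have "map_matrix (\<lambda>p. poly p z) (mat [:0, 1:] - map_matrix (\<lambda>a. [:a:]) A) = mat z - A"
    by (simp add: vec_eq_iff mat_def)
  ultimately show ?thesis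
    by (simp add: charpoly_def)
qed

lemma spectrum_eq_roots: "spectrum A = {z. poly (charpoly A) z = 0}"
  for A :: "complex ^'n^'n"
proof -
  have "(mat z - A) *v v = z *s v - A *v v" for z and v :: "complex ^'n"
    by (simp add: vec_eq_iff matrix_vector_mult_def mat_def left_diff_distrib sum_subtractf
        if_distrib [of "\<lambda>x. x * _"] cong: if_cong)
  then have "poly (charpoly A) z = 0 \<longleftrightarrow> (\<exists>v. v \<noteq> 0 \<and> A *v v = z *s v)" for z
    by (metis (no_types, lifting) poly_charpoly invertible_det_nz invertible_left_inverse
        matrix_left_invertible_ker right_minus_eq)
  then show ?thesis
    by (auto simp: spectrum_def)
qed

lemma finite_spectrum: "finite (spectrum A)"
  for A :: "complex ^'n^'n"
proof -
  have "linear ((*v) A)"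
    by (rule linearI)
       (simp_all add: vec_eq_iff matrix_vector_mult_def ring_distribs sum.distrib scaleR_sum_right)
  then obtain B where B: "norm (A *v v) \<le> B * norm v" for v
    using linear_bounded by blast
  have "complex_of_real (\<bar>B\<bar> + 1) \<notin> spectrum A"
  proof
    assume "complex_of_real (\<bar>B\<bar> + 1) \<in> spectrum A"
    then obtain v where v: "v \<noteq> 0" "A *v v = complex_of_real (\<bar>B\<bar> + 1) *s v"
      by (auto simp: spectrum_def)
    have "complex_of_real (\<bar>B\<bar> + 1) *s v = (\<bar>B\<bar> + 1) *\<^sub>R v"
      by (simp add: vec_eq_iff scaleR_conv_of_real [where 'a = complex] algebra_simps)
    with v B [of v] have "(\<bar>B\<bar> + 1) * norm v \<le> B * norm v"
      by simp
    with v show False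
      by simp
  qed
  then have "charpoly A \<noteq> 0"
    by (auto simp: spectrum_eq_roots)
  then show ?thesis
    by (simp add: spectrum_eq_roots poly_roots_finite)
qed


section \<open>The matrix \<open>L\<close>\<close>

text \<open>
  Irreducibility: no simultaneous permutation of rows and columns makes \<open>L\<close> block triangular, where
  \<open>S\<close> is the index set of one diagonal block. Every one by one matrix counts as irreducible.
\<close>

definition irreducible_matrix :: "real ^'n^'n \<Rightarrow> bool" where
  "irreducible_matrix L \<longleftrightarrow>
     \<not> (\<exists>S. S \<noteq> {} \<and> S \<noteq> UNIV \<and> (\<forall>i\<in>S. \<forall>j\<in>-S. L $ i $ j = 0))"

definition zero_column_sums :: "real ^'n^'n \<Rightarrow> bool" where
  "zero_column_sums L \<longleftrightarrow> (\<forall>j. (\<Sum>i\<in>UNIV. L $ i $ j) = 0)"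

definition eventually_exponentially_positive :: "real ^'n^'n \<Rightarrow> bool" where
  "eventually_exponentially_positive L \<longleftrightarrow>
     (\<exists>\<tau>\<^sub>0\<ge>0. \<forall>t\<ge>\<tau>\<^sub>0. \<forall>i j. 0 < matrix_exp (t *\<^sub>R L) $ i $ j)"

definition stationary_density :: "real ^'n^'n \<Rightarrow> real ^'n" where
  "stationary_density L = (THE p. L *v p = 0 \<and> (\<Sum>i\<in>UNIV. p $ i) = 1)"

definition projector_onto_along :: "(real ^'n) set \<Rightarrow> (real ^'n) set \<Rightarrow> real ^'n^'n" where
  "projector_onto_along U V =
     (THE R. R ** R = R \<and> range ((*v) R) = U \<and> {v. R *v v = 0} = V)"

text \<open>
  Kernel and range of \<open>L - \<mu>\<close> are complementary, as needed here, exactly if \<open>\<mu>\<close> is semisimple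
  or not an eigenvalue; a simple eigenvalue is semisimple.
\<close>

definition spectral_projector :: "real ^'n^'n \<Rightarrow> real \<Rightarrow> real ^'n^'n" where
  "spectral_projector L \<mu> =
     projector_onto_along {v. (L - mat \<mu>) *v v = 0} (range ((*v) (L - mat \<mu>)))"


section \<open>Rational functions\<close>

text \<open>
  A rational function is given by coprime polynomials \<open>P\<close> and \<open>Q \<noteq> 0\<close>. The value that division by
  zero assigns to \<open>rat_fun P Q\<close> at a root of \<open>Q\<close> is irrelevant to \<open>is_pole\<close> and to limits.
\<close>

definition rat_fun :: "complex poly \<Rightarrow> complex poly \<Rightarrow> complex \<Rightarrow> complex" where
  "rat_fun P Q z = poly P z / poly Q z"

definition A_acceptable :: "(complex \<Rightarrow> complex) \<Rightarrow> bool" where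
  "A_acceptable r \<longleftrightarrow> (\<forall>z. is_pole r z \<longrightarrow> 0 < Re z)"

text \<open>Meaningful only if no eigenvalue of \<open>M\<close> is a root of \<open>Q\<close>.\<close>

definition rat_matrix :: "complex poly \<Rightarrow> complex poly \<Rightarrow> complex ^'n^'n \<Rightarrow> complex ^'n^'n" where
  "rat_matrix P Q M = matrix_poly P M ** matrix_inv (matrix_poly Q M)"

end

theory Submission
  imports Defs
begin

text \<open>
  Adding all rows of \<open>z - L\<close> to one of them turns that row into \<open>(z, \<dots>, z)\<close>, because the column sums
  of \<open>L\<close> vanish. Hence \<open>charpoly L\<close> is \<open>z\<close> times the characteristic determinant with one row replaced
  by ones, and simplicity of the eigenvalue \<open>0\<close> means that the latter does not vanish at \<open>z = 0\<close>.
  So \<open>L v = w\<close> together with a prescribed sum of the entries of \<open>v\<close> has exactly one solution whenever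
  the entries of \<open>w\<close> add up to \<open>0\<close>. This yields the stationary density \<open>p\<close> and shows that the
  spectral projector \<open>\<Pi>\<close> is the matrix all of whose columns are \<open>p\<close>.

  Put \<open>N = 1 - \<Pi>\<close> and let \<open>d\<close> be the degree of \<open>Q\<close>. As \<open>L\<close> and \<open>\<Pi>\<close> annihilate each other,
  \<open>P (\<gamma> L) = C\<^sub>P(\<gamma>) (\<Pi> + \<gamma>\<^sup>d N)\<close> where \<open>C\<^sub>P(\<gamma>)\<close> tends to \<open>P(0) \<Pi> + P\<^sub>d L\<^sup>d N\<close>, and likewise for \<open>Q\<close>, where
  the limit is invertible. The factor \<open>\<Pi> + \<gamma>\<^sup>d N\<close> cancels in \<open>r (\<gamma> L)\<close>; the limit follows from
  \<open>P(0) = Q(0)\<close> and \<open>P\<^sub>d = r(\<infinity>) Q\<^sub>d\<close>.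
\<close>

no_notation fps_nth (infixl \<open>$\<close> 75)

section \<open>Matrix algebra\<close>

lemma matrix_scale_mult_left: "matrix_scale c X ** Y = matrix_scale c (X ** Y)"
  for X Y :: "'a::comm_ring_1 ^'n^'n"
  by (simp add: vec_eq_iff matrix_matrix_mult_def matrix_scale_def sum_distrib_left mult.assoc)

lemma matrix_scale_mult_right: "X ** matrix_scale c Y = matrix_scale c (X ** Y)"
  for X Y :: "'a::comm_ring_1 ^'n^'n"
  by (simp add: vec_eq_iff matrix_matrix_mult_def matrix_scale_def sum_distrib_left mult.left_commute)

lemma matrix_scale_scale [simp]: "matrix_scale c (matrix_scale d X) = matrix_scale (c * d) X"
  for X :: "'a::comm_ring_1 ^'n^'n"
  by (simp add: vec_eq_iff matrix_scale_def mult.assoc)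

lemma matrix_scale_0 [simp]: "matrix_scale 0 X = 0" "matrix_scale c (0 :: 'a ^'n^'n) = 0"
  for X :: "'a::comm_ring_1 ^'n^'n"
  by (simp_all add: vec_eq_iff matrix_scale_def)

lemma matrix_scale_1 [simp]: "matrix_scale 1 X = X"
  for X :: "'a::comm_ring_1 ^'n^'n"
  by (simp add: vec_eq_iff matrix_scale_def)

lemma matrix_scale_add: "matrix_scale c (X + Y) = matrix_scale c X + matrix_scale c Y"
  for X Y :: "'a::comm_ring_1 ^'n^'n"
  by (simp add: vec_eq_iff matrix_scale_def ring_distribs)

lemma matrix_scale_mult_vector: "matrix_scale c X *v v = c *s (X *v v)"
  for X :: "'a::comm_ring_1 ^'n^'n"
  by (simp add: vec_eq_iff matrix_vector_mult_def matrix_scale_def sum_distrib_left mult.assoc)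

lemma matrix_diff_ldistrib: "X ** (Y - Z) = X ** Y - X ** Z"
  for X Y Z :: "'a::comm_ring_1 ^'n^'n"
  by (simp add: vec_eq_iff matrix_matrix_mult_def ring_distribs sum_subtractf)

lemma matrix_diff_rdistrib: "(X - Y) ** Z = X ** Z - Y ** Z"
  for X Y Z :: "'a::comm_ring_1 ^'n^'n"
  by (simp add: vec_eq_iff matrix_matrix_mult_def ring_distribs sum_subtractf)

lemma matrix_add_rdistrib: "(X + Y) ** Z = X ** Z + Y ** Z"
  for X Y Z :: "'a::comm_ring_1 ^'n^'n"
  by (simp add: vec_eq_iff matrix_matrix_mult_def ring_distribs sum.distrib)

lemma matrix_sum_rdistrib: "(\<Sum>k\<in>K. F k) ** Z = (\<Sum>k\<in>K. F k ** Z)"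
  for F :: "'b \<Rightarrow> 'a::comm_ring_1 ^'n^'n" and Z :: "'a ^'n^'n"
  by (induction K rule: infinite_finite_induct) (simp_all add: matrix_add_rdistrib)

lemma matrix_power_0 [simp]: "matrix_power A 0 = mat 1"
  by (simp add: matrix_power_def)

lemma matrix_power_Suc: "matrix_power A (Suc k) = A ** matrix_power A k"
  by (simp add: matrix_power_def)

lemma matrix_power_scale:
  "matrix_power (matrix_scale c A) k = matrix_scale (c ^ k) (matrix_power A k)"
  for A :: "'a::comm_ring_1 ^'n^'n"
  by (induction k) (simp_all add: matrix_power_Suc matrix_scale_mult_left matrix_scale_mult_right mult.commute)

lemma matrix_poly_altdef:
  fixes A :: "'a::comm_ring_1 ^'n^'n"
  assumes "degree P \<le> d"
  shows "matrix_poly P A = (\<Sum>k\<le>d. matrix_scale (coeff P k) (matrix_power A k))"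
  unfolding matrix_poly_def
  by (rule sum.mono_neutral_left) (use assms in \<open>auto simp: coeff_eq_0\<close>)

text \<open>A right inverse of a square matrix over a field is two-sided, and two-sided inverses are
  unique; so the choice in \<open>matrix_inv\<close> can only pick \<open>Y\<close>.\<close>

lemma matrix_inv_eqI:
  fixes X Y :: "'a::field ^'n^'n"
  assumes "X ** Y = mat 1"
  shows "matrix_inv X = Y"
proof -
  have "Y ** X = mat 1"
    using assms by (simp add: matrix_left_right_inverse)
  with assms have "\<exists>Z. X ** Z = mat 1 \<and> Z ** X = mat 1"
    by blast
  then have "X ** matrix_inv X = mat 1 \<and> matrix_inv X ** X = mat 1"
    unfolding matrix_inv_def by (rule someI_ex)
  then show ?thesis
    by (metis \<open>Y ** X = mat 1\<close> matrix_mul_assoc matrix_mul_lid matrix_mul_rid)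
qed

lemma matrix_inv_right_nonzero_det:
  fixes X :: "'a::field ^'n^'n"
  assumes "det X \<noteq> 0"
  shows "X ** matrix_inv X = mat 1"
  using assms matrix_inv_eqI by (metis invertible_det_nz invertible_right_inverse)

text \<open>Linearity in row \<open>k\<close> splits the determinant into one summand for each
  \<open>j\<close>; every summand with \<open>j \<noteq> k\<close> has two equal rows.\<close>

lemma det_row_sum_all:
  fixes A :: "'a::comm_ring_1 ^'n^'n"
  shows "det (\<chi> i. if i = k then \<Sum>j\<in>UNIV. A $ j else A $ i) = det A"
proof -
  have "det (\<chi> i. if i = k then A $ j else A $ i) = (if j = k then det A else 0)" for j
  proof (cases "j = k")
    case True
    then have "(\<chi> i. if i = k then A $ j else A $ i) = A"
      by (simp add: vec_eq_iff)
    with True show ?thesis by simp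
  next
    case False
    then show ?thesis
      using det_identical_rows [OF False, of "\<chi> i. if i = k then A $ j else A $ i"]
      by (simp add: row_def)
  qed
  then show ?thesis
    using det_linear_row_sum [of UNIV k "\<lambda>_ j. A $ j" "\<lambda>i. A $ i"] by simp
qed

section \<open>Continuity of the determinant and of matrix inversion\<close>

lemma tendsto_matrixI:
  fixes M :: "'a::topological_space ^'n^'m"
  assumes "\<And>i j. ((\<lambda>x. f x $ i $ j) \<longlongrightarrow> M $ i $ j) F"
  shows "(f \<longlongrightarrow> M) F"
  by (intro vec_tendstoI assms)

lemma tendsto_matrix_mult:
  fixes X Y :: "'a::real_normed_algebra_1 ^'n^'n"
  assumes "(f \<longlongrightarrow> X) F" "(g \<longlongrightarrow> Y) F"
  shows "((\<lambda>x. f x ** g x) \<longlongrightarrow> X ** Y) F"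
  by (rule tendsto_matrixI)
     (auto simp: matrix_matrix_mult_def intro!: tendsto_intros tendsto_vec_nth assms)

lemma tendsto_matrix_scale:
  fixes X :: "'a::real_normed_algebra_1 ^'n^'n"
  assumes "(c \<longlongrightarrow> a) F" "(f \<longlongrightarrow> X) F"
  shows "((\<lambda>x. matrix_scale (c x) (f x)) \<longlongrightarrow> matrix_scale a X) F"
  by (rule tendsto_matrixI)
     (auto simp: matrix_scale_def intro!: tendsto_intros tendsto_vec_nth assms)

lemma tendsto_det:
  fixes X :: "'a::real_normed_field ^'n^'n"
  assumes "(f \<longlongrightarrow> X) F"
  shows "((\<lambda>x. det (f x)) \<longlongrightarrow> det X) F"
  unfolding det_def by (intro tendsto_intros tendsto_vec_nth assms)

text \<open>Column \<open>m\<close> of the inverse solves \<open>X x = axis m 1\<close>, so Cramer's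
  rule writes its entries as quotients of determinants. Continuity of inversion thereby reduces to
  that of \<open>det\<close>.\<close>

lemma matrix_inv_nth:
  fixes X :: "'a::field ^'n^'n"
  assumes "det X \<noteq> 0"
  shows "matrix_inv X $ k $ m = det (\<chi> i j. if j = k then axis m 1 $ i else X $ i $ j) / det X"
proof -
  have "X *v (matrix_inv X *v axis m 1) = axis m 1"
    by (simp add: matrix_vector_mul_assoc matrix_inv_right_nonzero_det assms)
  then have "matrix_inv X *v axis m 1 =
      (\<chi> k. det (\<chi> i j. if j = k then axis m 1 $ i else X $ i $ j) / det X)"
    using cramer [OF assms] by blast
  moreover have "(matrix_inv X *v axis m 1) $ k = matrix_inv X $ k $ m"
    by (simp add: matrix_vector_mult_def axis_def if_distrib [of "\<lambda>x. _ * x"] cong: if_cong)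
  ultimately show ?thesis by simp
qed

lemma tendsto_matrix_inv:
  fixes X :: "'a::real_normed_field ^'n^'n"
  assumes f: "(f \<longlongrightarrow> X) F" and X: "det X \<noteq> 0"
  shows "((\<lambda>x. matrix_inv (f x)) \<longlongrightarrow> matrix_inv X) F"
proof (rule tendsto_matrixI)
  fix k m
  have "\<forall>\<^sub>F x in F. det (f x) \<noteq> 0"
    by (rule tendsto_imp_eventually_ne [OF tendsto_det [OF f] X])
  then have "\<forall>\<^sub>F x in F. det (\<chi> i j. if j = k then axis m 1 $ i else f x $ i $ j) / det (f x)
      = matrix_inv (f x) $ k $ m"
    by eventually_elim (simp add: matrix_inv_nth)
  moreover have "((\<lambda>x. \<chi> i j. if j = k then axis m 1 $ i else f x $ i $ j)
      \<longlongrightarrow> (\<chi> i j. if j = k then axis m 1 $ i else X $ i $ j)) F"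
    by (rule tendsto_matrixI) (auto intro!: tendsto_intros tendsto_vec_nth f)
  then have "((\<lambda>x. det (\<chi> i j. if j = k then axis m 1 $ i else f x $ i $ j) / det (f x))
      \<longlongrightarrow> matrix_inv X $ k $ m) F"
    unfolding matrix_inv_nth [OF X] by (intro tendsto_divide tendsto_det f X)
  ultimately show "((\<lambda>x. matrix_inv (f x) $ k $ m) \<longlongrightarrow> matrix_inv X $ k $ m) F"
    by (rule Lim_transform_eventually [rotated])
qed

section \<open>Rational functions at infinity\<close>

lemma eventually_poly_neq_0_at_infinity:
  fixes Q :: "'a::real_normed_field poly"
  assumes "Q \<noteq> 0"
  shows "\<forall>\<^sub>F z in at_infinity. poly Q z \<noteq> 0"
proof -
  have "\<forall>\<^sub>F z in at_infinity. poly Q z / z ^ degree Q \<noteq> 0"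
    by (rule tendsto_imp_eventually_ne [OF poly_divide_tendsto_aux]) (simp add: assms)
  then show ?thesis
    by eventually_elim auto
qed

text \<open>Otherwise \<open>poly S z / z ^ degree S\<close> would be the given quotient, which
  tends to 0, times two factors with finite limits, and the leading coefficient of \<open>S\<close>
  would vanish. The alternative \<open>S = 0\<close> matters for constant \<open>Q\<close>, as the
  zero polynomial has degree 0.\<close>

lemma rat_fun_tendsto_zero_imp:
  fixes S Q :: "complex poly"
  assumes "((\<lambda>z. poly S z / poly Q z) \<longlongrightarrow> 0) at_infinity" and "Q \<noteq> 0"
  shows "S = 0 \<or> degree S < degree Q"
proof (rule ccontr)
  assume "\<not> ?thesis"
  then have S: "S \<noteq> 0" and deg: "degree Q \<le> degree S"
    by auto
  let ?m = "degree S - degree Q"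
  \<comment> \<open>For \<open>?m = 0\<close> this limit is \<open>0 ^ 0 = 1\<close>, so equal
    degrees need no separate case.\<close>
  have "((\<lambda>z::complex. inverse z ^ ?m) \<longlongrightarrow> 0 ^ ?m) at_infinity"
    by (intro tendsto_intros tendsto_inverse_0)
  then have "((\<lambda>z. poly S z / poly Q z * (poly Q z / z ^ degree Q) * inverse z ^ ?m)
      \<longlongrightarrow> 0 * lead_coeff Q * 0 ^ ?m) at_infinity"
    by (intro tendsto_mult assms poly_divide_tendsto_aux)
  moreover have "\<forall>\<^sub>F z in at_infinity.
      poly S z / poly Q z * (poly Q z / z ^ degree Q) * inverse z ^ ?m = poly S z / z ^ degree S"
  proof -
    have "\<forall>\<^sub>F z in at_infinity. poly Q z \<noteq> 0"
      by (rule eventually_poly_neq_0_at_infinity [OF assms(2)])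
    moreover have "\<forall>\<^sub>F z::complex in at_infinity. z \<noteq> 0"
      by (rule eventually_not_equal_at_infinity)
    ultimately show ?thesis
    proof eventually_elim
      case (elim z)
      have "z ^ degree S = z ^ degree Q * z ^ ?m"
        using deg by (simp flip: power_add)
      with elim show ?case
        by (simp add: field_simps)
    qed
  qed
  ultimately have "((\<lambda>z. poly S z / z ^ degree S) \<longlongrightarrow> 0) at_infinity"
    by (simp add: Lim_transform_eventually)
  then have "lead_coeff S = 0"
    using poly_divide_tendsto_aux tendsto_unique trivial_limit_at_infinity by blast
  with S show False by simp
qed

text \<open>Subtracting the limit leaves a quotient with numerator \<open>P - smult c Q\<close> that
  tends to 0, so this numerator contributes nothing to the coefficient at
  \<open>degree Q\<close>.\<close>

lemma rat_fun_tendsto_at_infinity_coeff: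
  assumes "(rat_fun P Q \<longlongrightarrow> c) at_infinity" and "Q \<noteq> 0"
  shows "degree P \<le> degree Q" and "coeff P (degree Q) = c * lead_coeff Q"
proof -
  let ?S = "P - smult c Q"
  have "\<forall>\<^sub>F z in at_infinity. poly Q z \<noteq> 0"
    by (rule eventually_poly_neq_0_at_infinity [OF assms(2)])
  then have "\<forall>\<^sub>F z in at_infinity. rat_fun P Q z - c = poly ?S z / poly Q z"
    by eventually_elim (simp add: rat_fun_def field_simps)
  moreover have "((\<lambda>z. rat_fun P Q z - c) \<longlongrightarrow> 0) at_infinity"
    using assms(1) by (simp add: LIM_zero_iff)
  ultimately have "((\<lambda>z. poly ?S z / poly Q z) \<longlongrightarrow> 0) at_infinity"
    by (rule Lim_transform_eventually [rotated])
  then have S: "?S = 0 \<or> degree ?S < degree Q"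
    using rat_fun_tendsto_zero_imp assms(2) by blast
  have P: "P = ?S + smult c Q"
    by simp
  have "degree ?S \<le> degree Q"
    using S by auto
  moreover have "degree (smult c Q) \<le> degree Q"
    by (rule degree_smult_le)
  ultimately show "degree P \<le> degree Q"
    by (subst P) (rule degree_add_le)
  have "coeff ?S (degree Q) = 0"
    using S by (auto simp: coeff_eq_0 simp del: coeff_diff)
  then show "coeff P (degree Q) = c * lead_coeff Q"
    by simp
qed

section \<open>Large scalings of a matrix with a complemented kernel\<close>

text \<open>Together the conditions make \<open>E\<close> the projector onto the kernel of
  \<open>A\<close> along its range; \<open>ker\<close> says that \<open>A\<close> is injective on
  the kernel of \<open>E\<close>.\<close>

locale kernel_projection =
  fixes A E :: "complex ^'n^'n"
  assumes idem: "E ** E = E"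
    and mult_E: "A ** E = 0"
    and E_mult: "E ** A = 0"
    and ker: "A *v v = 0 \<Longrightarrow> E *v v = 0 \<Longrightarrow> v = 0"
begin

definition N :: "complex ^'n^'n" where
  "N = mat 1 - E"

lemma EN [simp]: "E ** N = 0" and NE [simp]: "N ** E = 0" and NN [simp]: "N ** N = N"
  by (simp_all add: N_def matrix_diff_ldistrib matrix_diff_rdistrib idem)

lemma power_mult_E: "matrix_power A k ** E = (if k = 0 then E else 0)"
proof (induction k)
  case (Suc k)
  then show ?case
    by (simp add: matrix_power_Suc mult_E flip: matrix_mul_assoc split: if_splits)
qed simp

lemma E_mult_power: "E ** matrix_power A k = (if k = 0 then E else 0)"
  by (cases k) (simp_all add: matrix_power_Suc matrix_mul_assoc E_mult)

lemma power_mult_N: "matrix_power A k ** N = (if k = 0 then N else matrix_power A k)"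
  by (simp add: N_def matrix_diff_ldistrib power_mult_E)

lemma N_mult_power_N: "N ** (matrix_power A k ** N) = matrix_power A k ** N"
  by (simp add: power_mult_N) (simp add: N_def matrix_diff_rdistrib E_mult_power)

text \<open>\<open>A\<close> maps into the kernel of \<open>E\<close> and is injective there, so the
  factors of the power can be stripped one at a time.\<close>

lemma kernel_power:
  assumes "E *v v = 0" and "matrix_power A k *v v = 0"
  shows "v = 0"
  using assms(2)
proof (induction k)
  case (Suc k)
  then have "A *v (matrix_power A k *v v) = 0"
    by (simp add: matrix_power_Suc matrix_vector_mul_assoc)
  moreover have "E *v (matrix_power A k *v v) = 0"
    by (simp add: matrix_vector_mul_assoc E_mult_power assms(1))
  ultimately show ?case
    using ker Suc.IH by blast
qed simp

text \<open>
  With \<open>d\<close> at least the degree of \<open>P\<close>, this is \<open>P (c A)\<close> with its restriction to the range of \<open>A\<close>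
  divided by \<open>c ^ d\<close>. Unlike \<open>P (c A)\<close> itself it converges for large \<open>c\<close>.
\<close>

definition scaled_poly :: "nat \<Rightarrow> complex poly \<Rightarrow> complex \<Rightarrow> complex ^'n^'n" where
  "scaled_poly d P c = (\<Sum>k\<le>d. matrix_scale (coeff P k)
     ((if k = 0 then E else 0) + matrix_scale (c ^ k / c ^ d) (matrix_power A k ** N)))"

definition scaled_limit :: "nat \<Rightarrow> complex poly \<Rightarrow> complex ^'n^'n" where
  "scaled_limit d P =
     matrix_scale (coeff P 0) E + matrix_scale (coeff P d) (matrix_power A d ** N)"

text \<open>Products of \<open>E\<close> and \<open>N\<close> vanish, so the right factor acts on
  the two parts separately and restores the \<open>c ^ d\<close> divided out of the \<open>N\<close>
  part. The term \<open>E\<close> is present only for \<open>k = 0\<close> because higher powers of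
  \<open>A\<close> annihilate \<open>E\<close>.\<close>

lemma matrix_poly_eq_scaled_poly:
  assumes "c \<noteq> 0" and "degree P \<le> d"
  shows "matrix_poly P (matrix_scale c A) = scaled_poly d P c ** (E + matrix_scale (c ^ d) N)"
proof -
  have "((if k = 0 then E else 0) + matrix_scale (c ^ k / c ^ d) (matrix_power A k ** N))
      ** (E + matrix_scale (c ^ d) N) = matrix_scale (c ^ k) (matrix_power A k)" for k
  proof -
    have "((if k = 0 then E else 0) + matrix_scale (c ^ k / c ^ d) (matrix_power A k ** N))
      ** (E + matrix_scale (c ^ d) N)
      = (if k = 0 then E else 0) + matrix_scale (c ^ k) (matrix_power A k ** N)"
      using assms(1) by (simp add: matrix_add_ldistrib matrix_add_rdistrib idem
          matrix_scale_mult_left matrix_scale_mult_right flip: matrix_mul_assoc)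
    then show ?thesis
      by (simp add: power_mult_N) (simp add: N_def)
  qed
  then show ?thesis
    unfolding scaled_poly_def matrix_sum_rdistrib matrix_poly_altdef [OF assms(2)]
    by (simp add: matrix_scale_mult_left matrix_power_scale)
qed

lemma tendsto_scaled_poly:
  "((\<lambda>\<gamma>::real. scaled_poly d P (of_real \<gamma>)) \<longlongrightarrow> scaled_limit d P) at_top"
proof -
  have quot: "((\<lambda>\<gamma>::real. complex_of_real \<gamma> ^ k / of_real \<gamma> ^ d) \<longlongrightarrow> (if k = d then 1 else 0)) at_top"
    if "k \<le> d" for k
  proof -
    \<comment> \<open>The quotient equals \<open>inverse \<gamma> ^ (d - k)\<close>; at
      \<open>k = d\<close> the convention \<open>0 ^ 0 = 1\<close> gives the limit 1.\<close>
    have "((\<lambda>\<gamma>::real. inverse \<gamma> ^ (d - k)) \<longlongrightarrow> 0 ^ (d - k)) at_top"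
      by (intro tendsto_power tendsto_inverse_0_at_top filterlim_ident)
    then have "((\<lambda>\<gamma>::real. complex_of_real (inverse \<gamma> ^ (d - k))) \<longlongrightarrow> of_real (0 ^ (d - k))) at_top"
      by (rule tendsto_of_real)
    moreover have "\<forall>\<^sub>F \<gamma>::real in at_top.
        complex_of_real (inverse \<gamma> ^ (d - k)) = of_real \<gamma> ^ k / of_real \<gamma> ^ d"
      using eventually_gt_at_top [of "0::real"]
    proof eventually_elim
      case (elim \<gamma>)
      have "complex_of_real \<gamma> ^ d = of_real \<gamma> ^ k * of_real \<gamma> ^ (d - k)"
        using that by (simp flip: power_add)
      with elim show ?case
        by (simp add: field_simps)
    qed
    ultimately have "((\<lambda>\<gamma>::real. complex_of_real \<gamma> ^ k / of_real \<gamma> ^ d) \<longlongrightarrow> of_real (0 ^ (d - k))) at_top"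
      by (rule Lim_transform_eventually)
    with that show ?thesis
      by (auto simp: power_0_left split: if_splits)
  qed
  have "((\<lambda>\<gamma>::real. scaled_poly d P (of_real \<gamma>)) \<longlongrightarrow>
      (\<Sum>k\<le>d. matrix_scale (coeff P k) ((if k = 0 then E else 0) +
        matrix_scale (if k = d then 1 else 0) (matrix_power A k ** N)))) at_top"
    unfolding scaled_poly_def
    by (intro tendsto_sum tendsto_matrix_scale tendsto_add tendsto_const quot) simp
  moreover have "matrix_scale (coeff P k) ((if k = 0 then E else 0) +
        matrix_scale (if k = d then 1 else 0) (matrix_power A k ** N))
      = (if k = 0 then matrix_scale (coeff P k) E else 0) +
        (if k = d then matrix_scale (coeff P k) (matrix_power A k ** N) else 0)" for k
    by (simp add: matrix_scale_add)
  ultimately show ?thesis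
    by (simp add: sum.distrib scaled_limit_def)
qed

text \<open>Injectivity is checked part by part: multiplying by \<open>E\<close> isolates
  \<open>coeff Q 0\<close> times \<open>E v\<close>, so \<open>E v = 0\<close>; what remains is
  \<open>coeff Q d\<close> times \<open>A ^ d v\<close>, and powers of \<open>A\<close> are
  injective on the kernel of \<open>E\<close>.\<close>

lemma det_scaled_limit:
  assumes "coeff Q 0 \<noteq> 0" and "coeff Q d \<noteq> 0"
  shows "det (scaled_limit d Q) \<noteq> 0"
proof -
  have "v = 0" if "scaled_limit d Q *v v = 0" for v
  proof -
    have "E ** scaled_limit d Q = matrix_scale (coeff Q 0) E"
      by (simp add: scaled_limit_def matrix_add_ldistrib matrix_scale_mult_right idem
          matrix_mul_assoc E_mult_power)
    then have "coeff Q 0 *s (E *v v) = 0"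
      by (metis that matrix_scale_mult_vector matrix_vector_mul_assoc matrix_vector_mult_0_right)
    then have Ev: "E *v v = 0"
      using assms(1) by simp
    then have Nv: "N *v v = v"
      by (simp add: N_def matrix_vector_mult_diff_rdistrib)
    have "coeff Q d *s (matrix_power A d *v v) = 0"
      using that Ev by (simp add: scaled_limit_def matrix_vector_mult_add_rdistrib
          matrix_scale_mult_vector Nv flip: matrix_vector_mul_assoc)
    then show ?thesis
      using kernel_power [OF Ev] assms(2) by simp
  qed
  then show ?thesis
    by (metis invertible_det_nz invertible_left_inverse matrix_left_invertible_ker)
qed

text \<open>The two limits agree on the \<open>E\<close> part and differ by the factor
  \<open>c\<close> on the \<open>N\<close> part. Both facts are expressed by a left factor so that
  the limit for \<open>Q\<close> cancels against its inverse.\<close>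

lemma scaled_limit_eq:
  assumes "coeff P 0 = coeff Q 0" and "coeff P d = c * coeff Q d"
  shows "scaled_limit d P = (E + matrix_scale c N) ** scaled_limit d Q"
proof -
  have "E ** (matrix_power A d ** N) = 0"
    by (simp add: matrix_mul_assoc E_mult_power)
  then show ?thesis
    by (simp add: scaled_limit_def assms matrix_add_ldistrib matrix_add_rdistrib idem
        matrix_scale_mult_left matrix_scale_mult_right N_mult_power_N mult.commute)
qed

lemma tendsto_rat_matrix:
  assumes "degree P \<le> degree Q" and "Q \<noteq> 0" and "coeff Q 0 \<noteq> 0"
    and "coeff P 0 = coeff Q 0" and "coeff P (degree Q) = c * lead_coeff Q"
  shows "((\<lambda>\<gamma>::real. rat_matrix P Q (matrix_scale (of_real \<gamma>) A))
           \<longlongrightarrow> E + matrix_scale c (mat 1 - E)) at_top"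
proof -
  let ?d = "degree Q"
  let ?C = "\<lambda>P \<gamma>. scaled_poly ?d P (complex_of_real \<gamma>)"
  have det: "det (scaled_limit ?d Q) \<noteq> 0"
    by (rule det_scaled_limit) (use assms in simp_all)
  have "((\<lambda>\<gamma>. ?C P \<gamma> ** matrix_inv (?C Q \<gamma>))
      \<longlongrightarrow> scaled_limit ?d P ** matrix_inv (scaled_limit ?d Q)) at_top"
    by (intro tendsto_matrix_mult tendsto_matrix_inv tendsto_scaled_poly det)
  moreover have "scaled_limit ?d P ** matrix_inv (scaled_limit ?d Q) = E + matrix_scale c (mat 1 - E)"
    unfolding scaled_limit_eq [OF assms(4,5)]
    by (simp add: matrix_inv_right_nonzero_det det N_def flip: matrix_mul_assoc)
  moreover have "\<forall>\<^sub>F \<gamma> in at_top. ?C P \<gamma> ** matrix_inv (?C Q \<gamma>)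
      = rat_matrix P Q (matrix_scale (of_real \<gamma>) A)"
    using eventually_gt_at_top [of "0::real"]
      tendsto_imp_eventually_ne [OF tendsto_det [OF tendsto_scaled_poly] det]
  proof eventually_elim
    case (elim \<gamma>)
    let ?c = "complex_of_real \<gamma>"
    let ?T = "E + matrix_scale (?c ^ ?d) N"
    \<comment> \<open>The inverse of \<open>?T\<close>, obtained by inverting the scalar on the
      \<open>N\<close> part.\<close>
    let ?T' = "E + matrix_scale (inverse (?c ^ ?d)) N"
    have "?T ** ?T' = E + N"
      using elim(1) by (simp add: matrix_add_ldistrib matrix_add_rdistrib idem
          matrix_scale_mult_left matrix_scale_mult_right)
    then have T: "?T ** ?T' = mat 1"
      by (simp add: N_def)
    \<comment> \<open>For large \<open>\<gamma>\<close> the determinant of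
      \<open>?C Q \<gamma>\<close> is close to its nonzero limit, so \<open>matrix_inv\<close> is a
      genuine inverse here.\<close>
    have CQ: "?C Q \<gamma> ** matrix_inv (?C Q \<gamma>) = mat 1"
      using elim(2) by (rule matrix_inv_right_nonzero_det)
    have "(?C Q \<gamma> ** ?T) ** (?T' ** matrix_inv (?C Q \<gamma>)) = mat 1"
      by (metis T CQ matrix_mul_assoc matrix_mul_rid)
    then have "matrix_inv (?C Q \<gamma> ** ?T) = ?T' ** matrix_inv (?C Q \<gamma>)"
      by (rule matrix_inv_eqI)
    then have "rat_matrix P Q (matrix_scale ?c A) = ?C P \<gamma> ** ?T ** (?T' ** matrix_inv (?C Q \<gamma>))"
      using elim(1) assms(1) by (simp add: rat_matrix_def matrix_poly_eq_scaled_poly [of ?c _ ?d])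
    also have "\<dots> = ?C P \<gamma> ** matrix_inv (?C Q \<gamma>)"
      by (metis T matrix_mul_assoc matrix_mul_rid)
    finally show ?case ..
  qed
  ultimately show ?thesis
    by (simp add: Lim_transform_eventually)
qed

end

section \<open>Zero column sums and a simple eigenvalue zero\<close>

text \<open>Since the rows of \<open>A\<close> add up to zero, one row of \<open>A v = w\<close> is redundant if the entries of \<open>w\<close>
  add up to zero, and can be traded for a prescribed sum of the entries of \<open>v\<close>.\<close>

definition bordered :: "'n \<Rightarrow> 'a::comm_ring_1 ^'n^'n \<Rightarrow> 'a ^'n^'n" where
  "bordered k A = (\<chi> i. if i = k then \<chi> j. 1 else A $ i)"

lemma bordered_mult_vector:
  "(bordered k A *v v) $ i = (if i = k then \<Sum>j\<in>UNIV. v $ j else (A *v v) $ i)"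
  by (simp add: bordered_def matrix_vector_mult_def)

lemma sum_matrix_vector_mult_eq_0:
  fixes A :: "'a::comm_ring_1 ^'n^'n"
  assumes "\<forall>j. (\<Sum>i\<in>UNIV. A $ i $ j) = 0"
  shows "(\<Sum>i\<in>UNIV. (A *v v) $ i) = 0"
proof -
  have "(\<Sum>i\<in>UNIV. (A *v v) $ i) = (\<Sum>j\<in>UNIV. (\<Sum>i\<in>UNIV. A $ i $ j) * v $ j)"
    unfolding matrix_vector_mult_def
    by (simp add: sum_distrib_right) (rule sum.swap)
  with assms show ?thesis by simp
qed

lemma vec_eq_if_eq_except_one:
  fixes x y :: "'a::comm_ring_1 ^'n"
  assumes "\<And>i. i \<noteq> k \<Longrightarrow> x $ i = y $ i" and "(\<Sum>i\<in>UNIV. x $ i) = (\<Sum>i\<in>UNIV. y $ i)"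
  shows "x = y"
proof -
  have "x $ k + (\<Sum>i\<in>UNIV - {k}. x $ i) = y $ k + (\<Sum>i\<in>UNIV - {k}. y $ i)"
    using assms(2) by (simp add: sum.remove [of UNIV k])
  moreover have "(\<Sum>i\<in>UNIV - {k}. x $ i) = (\<Sum>i\<in>UNIV - {k}. y $ i)"
    using assms(1) by (intro sum.cong) auto
  ultimately have "x $ k = y $ k" by simp
  with assms(1) show ?thesis
    by (metis vec_eq_iff)
qed

text \<open>Equation \<open>k\<close> of \<open>A v = w\<close> follows from the others because both
  sides have entry sum 0. Hence the problem is equivalent to a square system with the bordered
  matrix, which Cramer's rule solves uniquely.\<close>

lemma bordered_solve:
  fixes A :: "'a::field ^'n^'n"
  assumes cols: "\<forall>j. (\<Sum>i\<in>UNIV. A $ i $ j) = 0" and det: "det (bordered k A) \<noteq> 0"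
    and w: "(\<Sum>i\<in>UNIV. w $ i) = 0"
  shows "\<exists>!v. A *v v = w \<and> (\<Sum>i\<in>UNIV. v $ i) = s"
proof -
  let ?B = "bordered k A" and ?b = "\<chi> i. if i = k then s else w $ i"
  have iff: "A *v v = w \<and> (\<Sum>i\<in>UNIV. v $ i) = s \<longleftrightarrow> ?B *v v = ?b" for v
  proof
    assume "?B *v v = ?b"
    then have *: "(if i = k then \<Sum>j\<in>UNIV. v $ j else (A *v v) $ i) = (if i = k then s else w $ i)" for i
      unfolding vec_eq_iff bordered_mult_vector by simp
    have "A *v v = w"
    proof (rule vec_eq_if_eq_except_one)
      show "(A *v v) $ i = w $ i" if "i \<noteq> k" for i
        using * [of i] that by simp
      show "(\<Sum>i\<in>UNIV. (A *v v) $ i) = (\<Sum>i\<in>UNIV. w $ i)"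
        by (simp add: sum_matrix_vector_mult_eq_0 cols w)
    qed
    with * [of k] show "A *v v = w \<and> (\<Sum>i\<in>UNIV. v $ i) = s" by simp
  qed (simp add: vec_eq_iff bordered_mult_vector)
  show ?thesis
    unfolding iff cramer [OF det] by simp
qed

lemma charpoly_eq_mult_bordered:
  fixes A :: "'a::comm_ring_1 ^'n^'n"
  assumes cols: "\<forall>j. (\<Sum>i\<in>UNIV. A $ i $ j) = 0"
  shows "charpoly A = [:0, 1:] * det (bordered k (mat [:0, 1:] - map_matrix (\<lambda>a. [:a:]) A))"
proof -
  let ?X = "mat [:0, 1:] - map_matrix (\<lambda>a. [:a:]) A"
  have const: "(\<Sum>i\<in>I. [:f i:]) = [:\<Sum>i\<in>I. f i:]" for f :: "'n \<Rightarrow> 'a" and I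
    by (induction I rule: infinite_finite_induct) auto
  have "(\<Sum>i\<in>UNIV. ?X $ i) = [:0, 1:] *s (\<chi> j. 1)"
    using cols by (simp add: vec_eq_iff mat_def sum_subtractf const)
  then have "charpoly A = det (\<chi> i. if i = k then [:0, 1:] *s (\<chi> j. 1) else ?X $ i)"
    using det_row_sum_all [of k ?X] by (simp only: charpoly_def)
  also have "\<dots> = [:0, 1:] * det (\<chi> i. if i = k then \<chi> j. 1 else ?X $ i)"
    by (rule det_row_mul)
  finally show ?thesis
    by (simp add: bordered_def)
qed

lemma det_bordered_neq_0:
  fixes A :: "complex ^'n^'n"
  assumes cols: "\<forall>j. (\<Sum>i\<in>UNIV. A $ i $ j) = 0" and simple: "simple_eigenvalue A 0"
  shows "det (bordered k A) \<noteq> 0"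
proof -
  let ?X = "mat [:0, 1:] - map_matrix (\<lambda>a. [:a:]) A"
  define q where "q = det (bordered k ?X)"
  have q: "charpoly A = [:0, 1:] * q"
    unfolding q_def by (rule charpoly_eq_mult_bordered [OF cols])
  \<comment> \<open>Otherwise every complex number would be an eigenvalue.\<close>
  have "charpoly A \<noteq> 0"
    using finite_spectrum [of A] infinite_UNIV_char_0 by (auto simp: spectrum_eq_roots)
  then have "q \<noteq> 0" and "order 0 (charpoly A) = order 0 [:0, 1 :: complex:] + order 0 q"
    by (auto simp: q order_mult simp del: mult_pCons_left)
  moreover have "order 0 [:0, 1 :: complex:] = 1"
    using order_power_n_n [of "0 :: complex" 1] by simp
  ultimately have "poly q 0 \<noteq> 0"
    using simple by (simp add: simple_eigenvalue_def order_root)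
  moreover have "poly (det B) 0 = det (map_matrix (\<lambda>p. poly p 0) B)" for B :: "complex poly ^'n^'n"
    by (simp add: det_def poly_sum poly_prod)
  \<comment> \<open>At \<open>z = 0\<close> the matrix \<open>z - A\<close> becomes
    \<open>- A\<close>; the sign is removed below by comparing kernels, as the two bordered matrices
    differ only in the signs of the rows other than \<open>k\<close>.\<close>
  moreover have "map_matrix (\<lambda>p. poly p 0) (bordered k ?X) = bordered k (- A)"
    by (simp add: vec_eq_iff bordered_def mat_def)
  ultimately have det: "det (bordered k (- A)) \<noteq> 0"
    by (simp add: q_def)
  have "v = 0" if "bordered k A *v v = 0" for v
  proof -
    have "(- A *v v) $ i = - (A *v v) $ i" for i
      by (simp add: matrix_vector_mult_def sum_negf)
    then have "bordered k (- A) *v v = 0"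
      using that by (auto simp: vec_eq_iff bordered_mult_vector split: if_splits)
    then show ?thesis
      by (metis det invertible_det_nz invertible_left_inverse matrix_left_invertible_ker)
  qed
  then show ?thesis
    by (metis invertible_det_nz invertible_left_inverse matrix_left_invertible_ker)
qed

section \<open>Descent to the reals: stationary density and spectral projector\<close>

lemma det_cmatrix: "det (cmatrix A) = of_real (det A)"
  by (simp add: det_def)

lemma cmatrix_scaleR: "cmatrix (c *\<^sub>R A) = matrix_scale (of_real c) (cmatrix A)"
  by (simp add: vec_eq_iff matrix_scale_def)

text \<open>Simplicity is a statement about the complex matrix, but the bordered determinant is the
  image of a real one, so the real system is uniquely solvable too.\<close>

lemma kernel_density_solve:
  fixes L :: "real ^'n^'n"
  assumes "zero_column_sums L" and "simple_eigenvalue (cmatrix L) 0"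
    and "(\<Sum>i\<in>UNIV. w $ i) = 0"
  shows "\<exists>!v. L *v v = w \<and> (\<Sum>i\<in>UNIV. v $ i) = s"
proof -
  have "\<forall>j. (\<Sum>i\<in>UNIV. cmatrix L $ i $ j) = 0"
    using assms(1) by (simp add: zero_column_sums_def flip: of_real_sum)
  then have "det (bordered k (cmatrix L)) \<noteq> 0" for k
    using det_bordered_neq_0 assms(2) by blast
  moreover have "bordered k (cmatrix L) = cmatrix (bordered k L)" for k
    by (simp add: vec_eq_iff bordered_def)
  ultimately have "det (bordered k L) \<noteq> 0" for k
    by (simp add: det_cmatrix)
  moreover have "\<forall>j. (\<Sum>i\<in>UNIV. L $ i $ j) = 0"
    using assms(1) by (simp add: zero_column_sums_def)
  ultimately show ?thesis
    using bordered_solve assms(3) by blast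
qed

lemma stationary_density:
  fixes L :: "real ^'n^'n"
  assumes "zero_column_sums L" and "simple_eigenvalue (cmatrix L) 0"
  shows "L *v stationary_density L = 0" and "(\<Sum>i\<in>UNIV. stationary_density L $ i) = 1"
proof -
  have "\<exists>!v. L *v v = 0 \<and> (\<Sum>i\<in>UNIV. v $ i) = 1"
    by (rule kernel_density_solve [OF assms]) simp
  from theI' [OF this]
  show "L *v stationary_density L = 0" "(\<Sum>i\<in>UNIV. stationary_density L $ i) = 1"
    by (simp_all add: stationary_density_def)
qed

text \<open>Split \<open>v\<close> into \<open>S v\<close> and \<open>v - S v\<close>: an idempotent
  \<open>R\<close> with the same range fixes the first summand and, having the same kernel,
  annihilates the second.\<close>

lemma projector_onto_along_eqI:
  fixes R :: "real ^'n^'n"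
  assumes "R ** R = R" and "range ((*v) R) = U" and "{v. R *v v = 0} = V"
  shows "projector_onto_along U V = R"
  unfolding projector_onto_along_def
proof (rule the_equality)
  fix S :: "real ^'n^'n"
  assume S: "S ** S = S \<and> range ((*v) S) = U \<and> {v. S *v v = 0} = V"
  have "S *v v = R *v v" for v
  proof -
    have "S *v v \<in> range ((*v) R)"
      using S assms(2) by blast
    then have "R *v (S *v v) = S *v v"
      using assms(1) by (metis matrix_vector_mul_assoc rangeE)
    moreover have "S *v (v - S *v v) = 0"
      using S by (simp add: matrix_vector_mult_diff_distrib matrix_vector_mul_assoc)
    then have "R *v (v - S *v v) = 0"
      using S assms(3) by blast
    ultimately show ?thesis
      by (simp add: matrix_vector_mult_diff_distrib)
  qed
  then show "S = R"
    by (simp add: matrix_eq)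
qed (use assms in simp)

text \<open>The matrix is the outer product of \<open>p\<close> with the all-ones vector.\<close>

lemma equal_columns_mult_vector: "(\<chi> i j. p $ i) *v v = (\<Sum>j\<in>UNIV. v $ j) *s p"
  for p :: "'a::comm_ring_1 ^'n"
  by (simp add: vec_eq_iff matrix_vector_mult_def mult.commute
      flip: sum_distrib_left sum_distrib_right)

lemma equal_columns_idem:
  fixes p :: "'a::comm_ring_1 ^'n"
  assumes "(\<Sum>i\<in>UNIV. p $ i) = 1"
  shows "(\<chi> i j. p $ i) ** (\<chi> i j. p $ i) = ((\<chi> i j. p $ i) :: 'a ^'n^'n)"
  using assms by (simp add: vec_eq_iff matrix_matrix_mult_def flip: sum_distrib_left)

lemma spectral_projector_eq:
  fixes L :: "real ^'n^'n"
  assumes L: "zero_column_sums L" "simple_eigenvalue (cmatrix L) 0"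
  shows "spectral_projector L 0 = (\<chi> i j. stationary_density L $ i)"
proof -
  let ?p = "stationary_density L"
  let ?E = "(\<chi> i j. ?p $ i) :: real ^'n^'n"
  note p = stationary_density [OF L]
  have "range ((*v) ?E) = {v. L *v v = 0}"
  proof (intro equalityI subsetI)
    fix v assume "v \<in> range ((*v) ?E)"
    then obtain c where "v = c *s ?p"
      unfolding equal_columns_mult_vector by blast
    then show "v \<in> {v. L *v v = 0}"
      using p(1) by (simp add: vector_scalar_commute)
  next
    fix v assume "v \<in> {v. L *v v = 0}"
    moreover have "L *v ((\<Sum>j\<in>UNIV. v $ j) *s ?p) = 0"
      using p(1) by (simp add: vector_scalar_commute)
    moreover have "(\<Sum>i\<in>UNIV. ((\<Sum>j\<in>UNIV. v $ j) *s ?p) $ i) = (\<Sum>j\<in>UNIV. v $ j)"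
      using p(2) by (simp flip: sum_distrib_left)
    \<comment> \<open>Both vectors lie in the kernel of \<open>L\<close> and have the same entry
      sum.\<close>
    ultimately have "v = (\<Sum>j\<in>UNIV. v $ j) *s ?p"
      using kernel_density_solve [OF L, of 0 "\<Sum>j\<in>UNIV. v $ j"] by auto
    then show "v \<in> range ((*v) ?E)"
      by (metis equal_columns_mult_vector rangeI)
  qed
  moreover have "{v. ?E *v v = 0} = range ((*v) L)"
  proof (intro equalityI subsetI)
    fix w assume "w \<in> {v. ?E *v v = 0}"
    then have "(\<Sum>i\<in>UNIV. w $ i) = 0"
      using p(2) by (auto simp: equal_columns_mult_vector)
    \<comment> \<open>Only existence is used; the prescribed entry sum 0 of the preimage is
      arbitrary.\<close>
    then show "w \<in> range ((*v) L)"
      using kernel_density_solve [OF L, of w 0] by blast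
  next
    fix w assume "w \<in> range ((*v) L)"
    then show "w \<in> {v. ?E *v v = 0}"
      using L(1) by (auto simp: zero_column_sums_def equal_columns_mult_vector sum_matrix_vector_mult_eq_0)
  qed
  ultimately show ?thesis
    unfolding spectral_projector_def
    by (intro projector_onto_along_eqI equal_columns_idem) (use p in simp_all)
qed

section \<open>Convergence of \<open>r (\<gamma> L)\<close> and the entries of its limit\<close>

theorem theorem2:
  fixes L Pi0 :: "real ^'n^'n"
    and p :: "real ^'n"
    and P Q :: "complex poly"
    and r :: "complex \<Rightarrow> complex"
    and r_inf :: complex
  assumes "irreducible_matrix L"
    and "zero_column_sums L"
    and "spectral_abscissa L = 0"
    and "simple_eigenvalue (cmatrix L) 0"
    and "eventually_exponentially_positive L"
    and "Pi0 = spectral_projector L 0"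
    and "p = stationary_density L"
    and "coprime P Q" and "Q \<noteq> 0" and "r = rat_fun P Q"
    and "A_acceptable r"
    and "r 0 = 1"
    and "(r \<longlongrightarrow> r_inf) at_infinity"
    and "\<forall>\<gamma>::real. \<gamma> > 0 \<longrightarrow> (\<forall>z. is_pole r z \<longrightarrow> z \<notin> spectrum (cmatrix (\<gamma> *\<^sub>R L)))"
  shows "let R = cmatrix Pi0 + matrix_scale r_inf (mat 1 - cmatrix Pi0) in
      ((\<lambda>\<gamma>::real. rat_matrix P Q (cmatrix (\<gamma> *\<^sub>R L))) \<longlongrightarrow> R) at_top
      \<and> (\<forall>i j. i \<noteq> j \<longrightarrow> R $ i $ j = of_real (p $ i) * (1 - r_inf))
      \<and> (\<forall>i. R $ i $ i = of_real (p $ i) + r_inf * (1 - of_real (p $ i)))"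
proof -
  note L = assms(2,4)
  have p: "L *v p = 0" "(\<Sum>i\<in>UNIV. p $ i) = 1"
    using stationary_density [OF L] assms(7) by simp_all
  define q :: "complex ^'n" where "q = (\<chi> i. of_real (p $ i))"
  have Pi0: "cmatrix Pi0 = (\<chi> i j. q $ i)"
    by (simp add: assms(6,7) spectral_projector_eq [OF L] q_def vec_eq_iff)
  have sum_q: "(\<Sum>i\<in>UNIV. q $ i) = 1"
    using p(2) by (simp add: q_def flip: of_real_sum)
  have "(cmatrix L *v q) $ i = of_real ((L *v p) $ i)" for i
    by (simp add: matrix_vector_mult_def q_def)
  then have Lq: "cmatrix L *v q = 0"
    by (simp add: p(1) vec_eq_iff)
  have cols: "\<forall>j. (\<Sum>i\<in>UNIV. cmatrix L $ i $ j) = 0"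
    using L(1) by (simp add: zero_column_sums_def flip: of_real_sum)
  interpret kernel_projection "cmatrix L" "cmatrix Pi0"
  proof
    show "cmatrix Pi0 ** cmatrix Pi0 = cmatrix Pi0"
      unfolding Pi0 by (rule equal_columns_idem [OF sum_q])
    show "cmatrix L ** cmatrix Pi0 = 0"
      using Lq by (simp add: Pi0 vec_eq_iff matrix_matrix_mult_def matrix_vector_mult_def)
    show "cmatrix Pi0 ** cmatrix L = 0"
      using cols by (simp add: Pi0 vec_eq_iff matrix_matrix_mult_def flip: sum_distrib_left)
    fix v assume v: "cmatrix L *v v = 0" "cmatrix Pi0 *v v = 0"
    then have "(\<Sum>i\<in>UNIV. v $ i) *s q = 0"
      by (simp add: Pi0 equal_columns_mult_vector)
    then have "(\<Sum>i\<in>UNIV. v $ i) = 0"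
      using sum_q by auto
    moreover have "\<exists>!v. cmatrix L *v v = 0 \<and> (\<Sum>i\<in>UNIV. v $ i) = 0"
      by (rule bordered_solve [OF cols det_bordered_neq_0 [OF cols L(2)]]) simp
    ultimately show "v = 0"
      using v(1) by (metis matrix_vector_mult_0_right sum.neutral zero_index)
  qed
  \<comment> \<open>Division by zero yields 0, so the value 1 also forces
    \<open>poly Q 0 \<noteq> 0\<close>.\<close>
  have "poly P 0 / poly Q 0 = 1"
    using assms(10,12) by (simp add: rat_fun_def)
  then have "coeff Q 0 \<noteq> 0" "coeff P 0 = coeff Q 0"
    by (auto simp: poly_0_coeff_0)
  then have "((\<lambda>\<gamma>::real. rat_matrix P Q (matrix_scale (of_real \<gamma>) (cmatrix L)))
      \<longlongrightarrow> cmatrix Pi0 + matrix_scale r_inf (mat 1 - cmatrix Pi0)) at_top"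
    using rat_fun_tendsto_at_infinity_coeff [of P Q r_inf] assms(9,10,13)
    by (intro tendsto_rat_matrix) simp_all
  then show ?thesis
    unfolding Let_def cmatrix_scaleR Pi0
    by (simp add: q_def matrix_scale_def mat_def algebra_simps)
qed

end
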